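(* Let $g:\mathbb{R}^m\to\mathbb{R}$ be a convex Fréchet differentiable function with $L_g$-Lipschitz continuous gradient, and assume that $\operatorname{argmin} g\neq\emptyset$. Let $t_0>0$, $u_0,v_0\in\mathbb{R}^m$, $\alpha>3$ and $\beta\ge 0$. Let $x:[t_0,+\infty)\to\mathbb{R}^m$ be the unique strong global solution of the dynamical system $$\ddot{x}(t)+\frac{\alpha}{t}\dot{x}(t)+\nabla g\left(x(t)+\frac{\beta}{t}\dot{x}(t)\right)=0,\qquad x(t_0)=u_0,\ \dot{x}(t_0)=v_0.$$ Then $x$ is bounded and there exist $K\ge 0$ and $t_1\ge t_0$ such that $$\|\dot{x}(t)\|\le\frac{K}{t}\quad\text{for all }t\ge t_1.$$ Further, $$\int_{t_0}^{+\infty}t\|\dot{x}(t)\|^2\,dt<+\infty,$$ and there exist $K_1\ge 0$ and $t_2\ge t_0$ such that $$g(x(t))-\min g\le\frac{K_1}{t^2}\quad\text{for all }t\ge t_2.$$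
   Context: $\mathbb{R}^m$ carries the Euclidean norm $\|\cdot\|$. That $\nabla g$ is $L_g$-Lipschitz means $L_g\ge 0$ and $\|\nabla g(x)-\nabla g(y)\|\le L_g\|x-y\|$ for all $x,y\in\mathbb{R}^m$. A function $x:[t_0,+\infty)\to\mathbb{R}^m$ is a strong global solution of the dynamical system if: (i) $x$ and $\dot x$ are locally absolutely continuous on $[t_0,+\infty)$ (i.e. absolutely continuous on every compact interval $[t_0,T]$, $T>t_0$); (ii) the differential equation holds for almost every $t\ge t_0$; (iii) $x(t_0)=u_0$ and $\dot x(t_0)=v_0$. Under the stated assumptions such a solution exists and is unique. *)

theory Defs
  imports "HOL-Analysis.Analysis"
begin

definition grad :: "('a::real_inner \<Rightarrow> real) \<Rightarrow> 'a \<Rightarrow> 'a" where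
  "grad g z = (THE D. GDERIV g z :> D)"

definition argmin_set :: "('a \<Rightarrow> real) \<Rightarrow> 'a set" where
  "argmin_set g = {z. \<forall>y. g z \<le> g y}"

text \<open>Only meaningful when the minimum is attained, i.e. when \<open>argmin_set g \<noteq> {}\<close>.\<close>

definition min_value :: "('a \<Rightarrow> real) \<Rightarrow> real" where
  "min_value g = (LEAST v. v \<in> range g)"

text \<open>A pair \<open>(c, d)\<close> in \<open>D\<close> stands for the open interval from \<open>c\<close> to \<open>d\<close>;
  adjacent intervals may share an endpoint.\<close>

definition absolutely_continuous_on :: "real \<Rightarrow> real \<Rightarrow> (real \<Rightarrow> 'a::real_normed_vector) \<Rightarrow> bool" where
  "absolutely_continuous_on a b f \<longleftrightarrow>
    (\<forall>\<epsilon>>0. \<exists>\<delta>>0. \<forall>D :: (real \<times> real) set.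
       finite D \<longrightarrow>
       (\<forall>(c, d)\<in>D. a \<le> c \<and> c < d \<and> d \<le> b) \<longrightarrow>
       disjoint_family_on (\<lambda>(c, d). {c<..<d}) D \<longrightarrow>
       (\<Sum>(c, d)\<in>D. d - c) < \<delta> \<longrightarrow>
       (\<Sum>(c, d)\<in>D. norm (f d - f c)) < \<epsilon>)"

definition locally_absolutely_continuous_from ::
    "real \<Rightarrow> (real \<Rightarrow> 'a::real_normed_vector) \<Rightarrow> bool" where
  "locally_absolutely_continuous_from t0 f \<longleftrightarrow> (\<forall>T>t0. absolutely_continuous_on t0 T f)"

text \<open>A function on \<open>[t0, \<infinity>)\<close> is represented by a total function whose values below \<open>t0\<close>
  are irrelevant; hence derivatives are taken within \<open>{t0..}\<close> (one-sided at \<open>t0\<close>).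
  Since \<^const>\<open>vector_derivative\<close> is arbitrary at points of non-differentiability,
  differentiability is always required separately below.\<close>

definition deriv_from :: "real \<Rightarrow> (real \<Rightarrow> 'a::real_normed_vector) \<Rightarrow> real \<Rightarrow> 'a" where
  "deriv_from t0 f t = vector_derivative f (at t within {t0..})"

definition strong_global_solution ::
    "('a::euclidean_space \<Rightarrow> real) \<Rightarrow> real \<Rightarrow> real \<Rightarrow> real \<Rightarrow> 'a \<Rightarrow> 'a \<Rightarrow> (real \<Rightarrow> 'a) \<Rightarrow> bool" where
  "strong_global_solution g \<alpha> \<beta> t0 u0 v0 x \<longleftrightarrow>
     x differentiable_on {t0..} \<and>
     locally_absolutely_continuous_from t0 x \<and>
     locally_absolutely_continuous_from t0 (deriv_from t0 x) \<and>
     (AE t in lborel. t0 \<le> t \<longrightarrow>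
        deriv_from t0 x differentiable (at t within {t0..}) \<and>
        deriv_from t0 (deriv_from t0 x) t + (\<alpha> / t) *\<^sub>R deriv_from t0 x t
          + grad g (x t + (\<beta> / t) *\<^sub>R deriv_from t0 x t) = 0) \<and>
     x t0 = u0 \<and> deriv_from t0 x t0 = v0"

end

(* The coefficients of the equation are continuous in t along a solution, and an absolutely
   continuous function is the integral of its almost-everywhere derivative, so the equation holds
   classically for t > t0. With y = x + (beta/t) x', z a minimizer and b = (alpha+1)/2, the energy
     t^2 (g y - g z) + |b (x - z) + t x'|^2 / 2 + b (alpha-3)/4 |x - z|^2
   then decreases at rate at least (alpha-3)/4 * t |x'|^2 for large t. Each nonnegative term is
   bounded by the initial energy, and the dissipation is integrable. Convexity transfers the bound
   on g y - g z to g x - g z, since grad g is bounded along x and |y - x| = O(1/t^2). *)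

theory Submission
  imports Defs
begin

section \<open>Absolute continuity and the fundamental theorem of calculus\<close>

text \<open>Both endpoints are compared with \<open>t\<close>. Since
  \<open>u \<le> t \<le> v\<close>, the errors \<open>e * (t - u)\<close> and
  \<open>e * (v - t)\<close> add up to exactly \<open>e * (v - u)\<close>, which is the local
  estimate for an interval tagged by \<open>t\<close>.\<close>

lemma has_vector_derivative_straddle:
  fixes f :: "real \<Rightarrow> 'a::real_normed_vector"
  assumes "(f has_vector_derivative D) (at t within S)" "e > 0"
  obtains d where "d > 0"
    "\<And>u v. \<lbrakk>u \<in> S; v \<in> S; u \<le> t; t \<le> v; {u..v} \<subseteq> ball t d\<rbrakk>
      \<Longrightarrow> norm ((v - u) *\<^sub>R D - (f v - f u)) \<le> e * (v - u)"
proof -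
  obtain d where "d > 0" and d: "\<And>y. \<lbrakk>y \<in> S; norm (y - t) < d\<rbrakk>
      \<Longrightarrow> norm (f y - f t - (y - t) *\<^sub>R D) \<le> e * norm (y - t)"
    using assms unfolding has_vector_derivative_def has_derivative_within_alt by blast
  show thesis
  proof (rule that[OF \<open>d > 0\<close>])
    fix u v assume uv: "u \<in> S" "v \<in> S" "u \<le> t" "t \<le> v" "{u..v} \<subseteq> ball t d"
    then have "u \<in> {u..v}" "v \<in> {u..v}" by auto
    with uv(5) have "u \<in> ball t d" "v \<in> ball t d" by blast+
    then have u: "norm (f u - f t - (u - t) *\<^sub>R D) \<le> e * (t - u)"
      and v: "norm (f v - f t - (v - t) *\<^sub>R D) \<le> e * (v - t)"
      using d[of u] d[of v] uv by (auto simp: dist_real_def)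
    have "(v - u) *\<^sub>R D - (f v - f u) = (f u - f t - (u - t) *\<^sub>R D) - (f v - f t - (v - t) *\<^sub>R D)"
      by (simp add: algebra_simps)
    then have "norm ((v - u) *\<^sub>R D - (f v - f u)) \<le>
        norm (f u - f t - (u - t) *\<^sub>R D) + norm (f v - f t - (v - t) *\<^sub>R D)"
      by (metis norm_triangle_ineq4)
    with u v show "norm ((v - u) *\<^sub>R D - (f v - f u)) \<le> e * (v - u)"
      by (simp add: algebra_simps)
  qed
qed

text \<open>Non-overlapping intervals inside \<open>U\<close> have total length at most the measure
  of \<open>U\<close>, so the definition applies to the family of their endpoints. This controls the
  part of a Riemann sum whose tags lie in a null set.\<close>

lemma absolutely_continuous_on_sum_tagged_less:
  fixes f :: "real \<Rightarrow> 'a::real_normed_vector"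
  assumes "absolutely_continuous_on a b f" "e > 0"
  obtains d where "d > 0"
    "\<And>p U. \<lbrakk>p tagged_partial_division_of {a..b}; open U; emeasure lborel U < ennreal d; \<Union>(snd ` p) \<subseteq> U\<rbrakk>
      \<Longrightarrow> (\<Sum>(x, K)\<in>p. norm (f (Sup K) - f (Inf K))) < e"
proof -
  obtain d where "d > 0" and *: "\<forall>D :: (real \<times> real) set. finite D \<longrightarrow>
       (\<forall>(u, v)\<in>D. a \<le> u \<and> u < v \<and> v \<le> b) \<longrightarrow>
       disjoint_family_on (\<lambda>(u, v). {u<..<v}) D \<longrightarrow>
       (\<Sum>(u, v)\<in>D. v - u) < d \<longrightarrow> (\<Sum>(u, v)\<in>D. norm (f v - f u)) < e"
    using assms unfolding absolutely_continuous_on_def by blast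
  have d: "(\<Sum>(u, v)\<in>D. norm (f v - f u)) < e"
    if "finite D" "\<forall>(u, v)\<in>D. a \<le> u \<and> u < v \<and> v \<le> b"
      "disjoint_family_on (\<lambda>(u, v). {u<..<v}) D" "(\<Sum>(u, v)\<in>D. v - u) < d" for D
    using * that by blast
  show thesis
  proof (rule that[OF \<open>d > 0\<close>])
    fix p :: "(real \<times> real set) set" and U :: "real set"
    assume p: "p tagged_partial_division_of {a..b}" and "open U"
      and U: "emeasure lborel U < ennreal d" "\<Union>(snd ` p) \<subseteq> U"
    note pD = tagged_partial_division_ofD[OF p]
    \<comment> \<open>Degenerate intervals are dropped: the definition asks for
      \<open>c < d\<close>, and several of them with different tags may share their endpoints. Their
      increments vanish, so the sum over \<open>p\<close> is recovered at the end.\<close>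
    define q where "q = {z\<in>p. Inf (snd z) < Sup (snd z)}"
    define h where "h = (\<lambda>z::real \<times> real set. (Inf (snd z), Sup (snd z)))"
    have K: "\<exists>u v. K = {u..v} \<and> u \<le> v \<and> Inf K = u \<and> Sup K = v \<and> a \<le> u \<and> v \<le> b \<and> {u..v} \<subseteq> U"
      if xK: "(x, K) \<in> p" for x K
    proof -
      obtain u v where "K = cbox u v" using pD(4)[OF xK] by blast
      moreover have "K \<subseteq> U" using U(2) xK by fastforce
      ultimately show ?thesis
        using pD(2,3)[OF xK] by (intro exI[of _ u] exI[of _ v]) (auto simp: subset_iff)
    qed
    have hK: "\<exists>u v. h z = (u, v) \<and> snd z = {u..v} \<and> u < v \<and> a \<le> u \<and> v \<le> b \<and> {u..v} \<subseteq> U"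
      if "z \<in> q" for z
      using that K[of "fst z" "snd z"] by (auto simp: q_def h_def)
    have fin: "finite q" using pD(1) by (simp add: q_def)
    have dis: "{u<..<v} \<inter> {u'<..<v'} = {}"
      if "z \<in> q" "z' \<in> q" "z \<noteq> z'" "h z = (u, v)" "h z' = (u', v')" for z z' u v u' v'
    proof -
      have "interior (snd z) \<inter> interior (snd z') = {}"
        using pD(5)[of "fst z" "snd z" "fst z'" "snd z'"] that(1,2,3) by (simp add: q_def prod_eq_iff)
      moreover have "snd z = {u..v}" "snd z' = {u'..v'}"
        using hK[OF that(1)] hK[OF that(2)] that(4,5) by auto
      ultimately show ?thesis by simp
    qed
    \<comment> \<open>Two distinct elements of \<open>q\<close> with the same endpoints would give
      one nonempty open interval disjoint from itself.\<close>
    have inj: "inj_on h q"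
    proof (rule inj_onI, rule ccontr)
      fix z z' assume z: "z \<in> q" "z' \<in> q" "h z = h z'" "z \<noteq> z'"
      then obtain u v where "h z = (u, v)" "u < v" using hK by blast
      with dis[of z z' u v u v] z show False by auto
    qed
    have disj: "disjoint_family_on (\<lambda>(u, v). {u<..<v}) (h ` q)"
      unfolding disjoint_family_on_def
    proof (intro ballI impI)
      fix w w' assume "w \<in> h ` q" "w' \<in> h ` q" "w \<noteq> w'"
      then obtain z z' where z: "z \<in> q" "z' \<in> q" "z \<noteq> z'" "h z = w" "h z' = w'" by blast
      obtain u v u' v' where w: "w = (u, v)" "w' = (u', v')" by (meson surj_pair)
      show "(case w of (u, v) \<Rightarrow> {u<..<v}) \<inter> (case w' of (u, v) \<Rightarrow> {u<..<v}) = {}"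
        using dis[OF z(1-3), of u v u' v'] z(4,5) unfolding w by (simp only: prod.case simp_thms)
    qed
    have hq: "a \<le> u \<and> u < v \<and> v \<le> b \<and> {u..v} \<subseteq> U" if "(u, v) \<in> h ` q" for u v
    proof -
      from that obtain z where z: "(u, v) = h z" "z \<in> q" by (rule imageE)
      from hK[OF z(2)] show ?thesis by (simp flip: z(1))
    qed
    have sub: "(\<Union>(u, v)\<in>h ` q. {u<..<v}) \<subseteq> U"
    proof (intro UN_least)
      fix w assume "w \<in> h ` q"
      then show "(case w of (u, v) \<Rightarrow> {u<..<v}) \<subseteq> U"
        using hq[of "fst w" "snd w"] by (auto simp: subset_iff case_prod_unfold)
    qed
    have "ennreal (\<Sum>(u, v)\<in>h ` q. v - u) = (\<Sum>w\<in>h ` q. emeasure lborel (case w of (u, v) \<Rightarrow> {u<..<v}))"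
      by (subst sum_ennreal[symmetric]) (auto intro!: sum.cong dest!: hq)
    also have "\<dots> = emeasure lborel (\<Union>(u, v)\<in>h ` q. {u<..<v})"
      by (rule sum_emeasure) (use disj fin in auto)
    also have "\<dots> \<le> emeasure lborel U"
      by (rule emeasure_mono) (use sub \<open>open U\<close> in auto)
    also have "\<dots> < ennreal d" by (rule U)
    finally have "(\<Sum>(u, v)\<in>h ` q. v - u) < d"
      using \<open>d > 0\<close> by (metis ennreal_leI not_le)
    then have "(\<Sum>(u, v)\<in>h ` q. norm (f v - f u)) < e"
    proof (intro d)
      show "\<forall>(u, v)\<in>h ` q. a \<le> u \<and> u < v \<and> v \<le> b"
      proof
        fix w assume "w \<in> h ` q"
        then show "case w of (u, v) \<Rightarrow> a \<le> u \<and> u < v \<and> v \<le> b"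
          using hq[of "fst w" "snd w"] by (simp add: case_prod_unfold)
      qed
    qed (use fin disj in simp_all)
    also have "(\<Sum>(u, v)\<in>h ` q. norm (f v - f u)) = (\<Sum>z\<in>q. norm (f (Sup (snd z)) - f (Inf (snd z))))"
      by (subst sum.reindex[OF inj]) (simp add: h_def)
    also have "\<dots> = (\<Sum>z\<in>p. norm (f (Sup (snd z)) - f (Inf (snd z))))"
    proof (rule sum.mono_neutral_left[OF pD(1)])
      show "\<forall>z\<in>p - q. norm (f (Sup (snd z)) - f (Inf (snd z))) = 0"
      proof
        fix z assume "z \<in> p - q"
        with K[of "fst z" "snd z"] show "norm (f (Sup (snd z)) - f (Inf (snd z))) = 0"
          by (auto simp: q_def)
      qed
    qed (simp add: q_def)
    finally show "(\<Sum>(x, K)\<in>p. norm (f (Sup K) - f (Inf K))) < e"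
      by (simp add: case_prod_unfold)
  qed
qed

text \<open>The gauge follows the derivative at tags outside \<open>N\<close>; at tags in \<open>N\<close> it forces the intervals into
  an open cover of \<open>N\<close> so small that absolute continuity bounds their total increment.\<close>

lemma absolutely_continuous_on_has_integral:
  fixes f :: "real \<Rightarrow> 'a::banach"
  assumes ac: "absolutely_continuous_on a b f" and "a \<le> b" and N: "negligible N"
    and deriv: "\<And>t. t \<in> {a..b} - N \<Longrightarrow> (f has_vector_derivative f' t) (at t within {a..b})"
  shows "(f' has_integral f b - f a) {a..b}"
proof (cases "a = b")
  case True
  then show ?thesis using has_integral_refl(2)[of f' a] by simp
next
  case False
  then have "a < b" using \<open>a \<le> b\<close> by simp
  \<comment> \<open>With the value 0 on \<open>N\<close>, a tag in \<open>N\<close> contributes only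
    the increment of \<open>f\<close> to the error. The final spike argument restores
    \<open>f'\<close>.\<close>
  define F where "F t = (if t \<in> N then 0 else f' t)" for t
  have "(F has_integral f b - f a) {a..b}"
    unfolding has_integral_factor_content_real
  proof (intro allI impI)
    fix e :: real assume "e > 0"
    have "\<exists>d>0. \<forall>u v. u \<in> {a..b} \<longrightarrow> v \<in> {a..b} \<longrightarrow> u \<le> t \<longrightarrow> t \<le> v \<longrightarrow> {u..v} \<subseteq> ball t d
      \<longrightarrow> norm ((v - u) *\<^sub>R F t - (f v - f u)) \<le> e / 2 * (v - u)" if "t \<in> {a..b} - N" for t
    proof -
      have D: "(f has_vector_derivative F t) (at t within {a..b})"
        using deriv[OF that] that by (simp add: F_def)
      show ?thesis
        using has_vector_derivative_straddle[OF D, of "e / 2"] \<open>e > 0\<close> by (metis half_gt_zero)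
    qed
    then obtain r where r: "\<And>t. t \<in> {a..b} - N \<Longrightarrow> r t > 0"
      "\<And>t u v. \<lbrakk>t \<in> {a..b} - N; u \<in> {a..b}; v \<in> {a..b}; u \<le> t; t \<le> v; {u..v} \<subseteq> ball t (r t)\<rbrakk>
        \<Longrightarrow> norm ((v - u) *\<^sub>R F t - (f v - f u)) \<le> e / 2 * (v - u)"
      by metis
    \<comment> \<open>The integral criterion in use allows an error \<open>e\<close> times the
      length of the interval, and each of the two kinds of tags receives half of it. Positivity of
      this share is why \<open>a = b\<close> is treated separately.\<close>
    have "e / 2 * (b - a) > 0" using \<open>e > 0\<close> \<open>a < b\<close> by simp
    from absolutely_continuous_on_sum_tagged_less[OF ac this] obtain d where "d > 0"
      and d: "\<And>p U. \<lbrakk>p tagged_partial_division_of {a..b}; open U; emeasure lborel U < ennreal d; \<Union>(snd ` p) \<subseteq> U\<rbrakk>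
        \<Longrightarrow> (\<Sum>(x, K)\<in>p. norm (f (Sup K) - f (Inf K))) < e / 2 * (b - a)"
      by blast
    have null: "N \<in> null_sets lebesgue" using N by (simp add: negligible_iff_null_sets)
    then have "N \<in> sets lebesgue" by auto
    from sets_lebesgue_outer_open[OF this \<open>d > 0\<close>] obtain U where U: "open U" "N \<subseteq> U"
        "emeasure lebesgue (U - N) < ennreal d"
      by metis
    have "emeasure lborel U < ennreal d"
      using U(1,3) emeasure_Diff_null_set[OF null, of U] by simp
    have "\<exists>s>0. ball t s \<subseteq> U" if "t \<in> N" for t
      using that U by (meson openE subsetD)
    then obtain s where s: "\<And>t. t \<in> N \<Longrightarrow> s t > 0" "\<And>t. t \<in> N \<Longrightarrow> ball t (s t) \<subseteq> U"
      by metis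
    \<comment> \<open>The value 1 only makes the gauge total; tags of a division lie in
      \<open>{a..b}\<close>.\<close>
    define \<rho> where "\<rho> t = (if t \<in> N then s t else if t \<in> {a..b} then r t else 1)" for t
    have "\<rho> t > 0" for t using r(1) s(1) by (auto simp: \<rho>_def)
    then have g: "gauge (\<lambda>t. ball t (\<rho> t))" by (rule gauge_ball_dependent[rule_format])
    have est: "norm ((\<Sum>(x, K)\<in>p. measure lborel K *\<^sub>R F x) - (f b - f a)) \<le> e * measure lborel {a..b}"
      if p: "p tagged_division_of {a..b}" and fine: "(\<lambda>t. ball t (\<rho> t)) fine p" for p
    proof -
      note pD = tagged_division_ofD[OF p]
      define E where "E z = measure lborel (snd z) *\<^sub>R F (fst z) - (f (Sup (snd z)) - f (Inf (snd z)))" for z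
      define p1 where "p1 = {z\<in>p. fst z \<notin> N}"
      define p2 where "p2 = {z\<in>p. fst z \<in> N}"
      have pp: "p = p1 \<union> p2" "p1 \<inter> p2 = {}" "finite p1" "finite p2"
        using pD(1) by (auto simp: p1_def p2_def)
      have K: "\<exists>u v. K = {u..v} \<and> u \<le> x \<and> x \<le> v \<and> Inf K = u \<and> Sup K = v \<and> measure lborel K = v - u \<and> a \<le> u \<and> v \<le> b"
        if xK: "(x, K) \<in> p" for x K
      proof -
        obtain u v where "K = cbox u v" using pD(4)[OF xK] by blast
        with pD(2,3)[OF xK] show ?thesis
          by (intro exI[of _ u] exI[of _ v]) (auto simp: subset_iff)
      qed
      \<comment> \<open>Telescoping over the division, once for the identity and once for
        \<open>f\<close>.\<close>
      have ba: "b - a = (\<Sum>z\<in>p. Sup (snd z) - Inf (snd z))" "f b - f a = (\<Sum>z\<in>p. f (Sup (snd z)) - f (Inf (snd z)))"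
        using additive_tagged_division_1[OF \<open>a \<le> b\<close> p, of "\<lambda>x. x"] additive_tagged_division_1[OF \<open>a \<le> b\<close> p, of f]
        by (simp_all add: case_prod_unfold)
      have "norm (sum E p1) \<le> (\<Sum>z\<in>p1. e / 2 * (Sup (snd z) - Inf (snd z)))"
      proof (rule sum_norm_le)
        fix z assume "z \<in> p1"
        then have z: "(fst z, snd z) \<in> p" "fst z \<notin> N" by (auto simp: p1_def)
        from K[OF z(1)] obtain u v where uv: "snd z = {u..v}" "u \<le> fst z" "fst z \<le> v"
            "Inf (snd z) = u" "Sup (snd z) = v" "measure lborel (snd z) = v - u" "a \<le> u" "v \<le> b"
          by blast
        have "{u..v} \<subseteq> ball (fst z) (\<rho> (fst z))"
          using fineD[OF fine z(1)] uv(1) by simp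
        moreover have "fst z \<in> {a..b} - N" "u \<in> {a..b}" "v \<in> {a..b}"
          using z(2) uv(2,3,7,8) by auto
        ultimately have "norm ((v - u) *\<^sub>R F (fst z) - (f v - f u)) \<le> e / 2 * (v - u)"
          using uv(2,3) by (intro r(2)) (auto simp: \<rho>_def)
        then show "norm (E z) \<le> e / 2 * (Sup (snd z) - Inf (snd z))"
          by (simp only: E_def uv(4-6))
      qed
      also have "\<dots> \<le> (\<Sum>z\<in>p. e / 2 * (Sup (snd z) - Inf (snd z)))"
      proof (rule sum_mono2[OF pD(1)])
        show "0 \<le> e / 2 * (Sup (snd z) - Inf (snd z))" if "z \<in> p - p1" for z
          using K[of "fst z" "snd z"] that \<open>e > 0\<close> by auto
      qed (simp add: p1_def)
      also have "\<dots> = e / 2 * (b - a)"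
        by (simp only: ba(1) sum_distrib_left)
      finally have 1: "norm (sum E p1) \<le> e / 2 * (b - a)" .
      have "norm (sum E p2) \<le> (\<Sum>z\<in>p2. norm (f (Sup (snd z)) - f (Inf (snd z))))"
        by (rule sum_norm_le) (simp add: E_def p2_def F_def norm_minus_commute)
      also have "\<dots> = (\<Sum>(x, K)\<in>p2. norm (f (Sup K) - f (Inf K)))"
        by (simp add: case_prod_unfold)
      also have "\<dots> < e / 2 * (b - a)"
      proof (rule d[OF _ \<open>open U\<close> \<open>emeasure lborel U < ennreal d\<close>])
        show "p2 tagged_partial_division_of {a..b}"
          using p by (auto simp: tagged_division_of_def p2_def intro: tagged_partial_division_subset)
        show "\<Union> (snd ` p2) \<subseteq> U"
        proof (intro UN_least, simp only: p2_def)
          fix z assume z: "z \<in> {z \<in> p. fst z \<in> N}"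
          then have "snd z \<subseteq> ball (fst z) (\<rho> (fst z))"
            using fineD[OF fine, of "fst z" "snd z"] by simp
          with z s(2)[of "fst z"] show "snd z \<subseteq> U" by (simp add: \<rho>_def)
        qed
      qed
      finally have 2: "norm (sum E p2) < e / 2 * (b - a)" .
      have "(\<Sum>(x, K)\<in>p. measure lborel K *\<^sub>R F x) - (f b - f a) = sum E p"
        unfolding ba(2) E_def by (simp add: sum_subtractf case_prod_unfold)
      also have "\<dots> = sum E p1 + sum E p2"
        using pp by (metis sum.union_disjoint)
      also have "norm \<dots> \<le> norm (sum E p1) + norm (sum E p2)" by (rule norm_triangle_ineq)
      also have "\<dots> \<le> e * (b - a)" using 1 2 by (simp add: field_simps)
      finally show ?thesis using \<open>a \<le> b\<close> by simp
    qed
    show "\<exists>d. gauge d \<and> (\<forall>p. p tagged_division_of {a..b} \<and> d fine p \<longrightarrow>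
        norm ((\<Sum>(x, K)\<in>p. measure lborel K *\<^sub>R F x) - (f b - f a)) \<le> e * measure lborel {a..b})"
      by (intro exI[of _ "\<lambda>t. ball t (\<rho> t)"] conjI g allI impI est) auto
  qed
  then show ?thesis
    by (rule has_integral_spike[OF N, rotated]) (simp add: F_def)
qed

section \<open>Gradients and the tangent inequality for convex functions\<close>

text \<open>Justifies the definite description in \<open>grad\<close>: the adjoint of the
  derivative, evaluated at 1, represents it as an inner product, and uniqueness of the derivative
  makes this vector unique.\<close>

lemma GDERIV_grad:
  fixes g :: "'a::euclidean_space \<Rightarrow> real"
  assumes "g differentiable (at z)"
  shows "GDERIV g z :> grad g z"
proof -
  obtain g' where g': "(g has_derivative g') (at z)"
    using assms by (auto simp: differentiable_def)
  then have "linear g'" by (rule has_derivative_linear)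
  then have "g' = (\<lambda>h. h \<bullet> adjoint g' 1)" by (simp add: adjoint_works)
  with g' have ex: "GDERIV g z :> adjoint g' 1" by (simp add: gderiv_def)
  have "D = adjoint g' 1" if "GDERIV g z :> D" for D
    using has_derivative_unique[OF that[unfolded gderiv_def] ex[unfolded gderiv_def]]
    by (metis vector_eq_ldot)
  with ex show ?thesis unfolding grad_def by (rule theI)
qed

lemma GDERIV_imp_has_real_derivative:
  assumes "(y has_vector_derivative y') (at t)" "GDERIV g (y t) :> D"
  shows "((\<lambda>t. g (y t)) has_real_derivative (y' \<bullet> D)) (at t)"
  using has_derivative_compose[OF assms[unfolded has_vector_derivative_def gderiv_def]]
  by (simp add: has_field_derivative_def mult_commute_abs)

text \<open>Restriction to the line through \<open>w\<close> and \<open>z\<close> reduces the claim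
  to the tangent inequality for a convex function of one real variable.\<close>

lemma convex_on_above_gderiv:
  fixes g :: "'a::real_inner \<Rightarrow> real"
  assumes "convex_on UNIV g" "GDERIV g w :> D"
  shows "g z \<ge> g w + (z - w) \<bullet> D"
proof -
  define \<phi> where "\<phi> s = g (w + s *\<^sub>R (z - w))" for s :: real
  have "convex_on UNIV \<phi>"
  proof (rule convex_onI)
    fix s a b :: real assume "0 < s" "s < 1"
    have "w + ((1 - s) *\<^sub>R a + s *\<^sub>R b) *\<^sub>R (z - w)
        = (1 - s) *\<^sub>R (w + a *\<^sub>R (z - w)) + s *\<^sub>R (w + b *\<^sub>R (z - w))"
      by (simp add: algebra_simps)
    then show "\<phi> ((1 - s) *\<^sub>R a + s *\<^sub>R b) \<le> (1 - s) * \<phi> a + s * \<phi> b"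
      unfolding \<phi>_def using convex_onD[OF assms(1), of s] \<open>0 < s\<close> \<open>s < 1\<close> by simp
  qed auto
  moreover have "((\<lambda>s. w + s *\<^sub>R (z - w)) has_vector_derivative (z - w)) (at 0)"
    by (auto intro!: derivative_eq_intros)
  then have "(\<phi> has_real_derivative (z - w) \<bullet> D) (at 0)"
    unfolding \<phi>_def by (rule GDERIV_imp_has_real_derivative) (use assms(2) in simp)
  ultimately have "\<phi> 1 - \<phi> 0 \<ge> (z - w) \<bullet> D * (1 - 0)"
    by (intro convex_on_imp_above_tangent[of UNIV \<phi> 0 1]) auto
  then show ?thesis by (simp add: \<phi>_def)
qed

section \<open>Continuity, squared norms and integrability on a half-line\<close>

lemma absolutely_continuous_on_imp_continuous_on:
  fixes f :: "real \<Rightarrow> 'a::real_normed_vector"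
  assumes "absolutely_continuous_on a b f"
  shows "continuous_on {a..b} f"
  unfolding continuous_on_iff
proof (intro ballI allI impI)
  fix t e :: real assume t: "t \<in> {a..b}" and "e > 0"
  then obtain d where "d > 0" and d: "\<forall>D :: (real \<times> real) set. finite D \<longrightarrow>
       (\<forall>(u, v)\<in>D. a \<le> u \<and> u < v \<and> v \<le> b) \<longrightarrow>
       disjoint_family_on (\<lambda>(u, v). {u<..<v}) D \<longrightarrow>
       (\<Sum>(u, v)\<in>D. v - u) < d \<longrightarrow> (\<Sum>(u, v)\<in>D. norm (f v - f u)) < e"
    using assms unfolding absolutely_continuous_on_def by blast
  have *: "norm (f v - f u) < e" if "a \<le> u" "u < v" "v \<le> b" "v - u < d" for u v
    using d[rule_format, of "{(u, v)}"] that by (simp add: disjoint_family_on_def)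
  have "dist (f s) (f t) < e" if "s \<in> {a..b}" "dist s t < d" for s
    using *[of s t] *[of t s] that t \<open>e > 0\<close>
    by (cases s t rule: linorder_cases) (auto simp: dist_norm norm_minus_commute)
  with \<open>d > 0\<close> show "\<exists>d>0. \<forall>s\<in>{a..b}. dist s t < d \<longrightarrow> dist (f s) (f t) < e"
    by blast
qed

lemma has_real_derivative_norm_power2:
  fixes w :: "real \<Rightarrow> 'a::real_inner"
  assumes "(w has_vector_derivative w') (at t)"
  shows "((\<lambda>t. (norm (w t))\<^sup>2) has_real_derivative 2 * (w t \<bullet> w')) (at t)"
  using bounded_bilinear.has_vector_derivative[OF bounded_bilinear_inner assms assms]
  by (simp add: has_real_derivative_iff_has_vector_derivative power2_norm_eq_inner inner_commute)

text \<open>Lyapunov argument: a primitive \<open>F\<close> of \<open>h\<close> makes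
  \<open>F + E\<close> nonincreasing, so \<open>E \<ge> 0\<close> bounds \<open>F\<close> from
  above. Being nondecreasing, \<open>F\<close> converges, and the fundamental theorem on the
  half-line gives a finite integral.\<close>

lemma set_integrable_atLeast_dissipation:
  fixes h E E' :: "real \<Rightarrow> real"
  assumes cont: "continuous_on {a..} h" and nonneg: "\<And>t. t \<ge> a \<Longrightarrow> 0 \<le> h t"
    and E: "\<And>t. t \<ge> a \<Longrightarrow> 0 \<le> E t"
    and deriv: "\<And>t. t \<ge> a \<Longrightarrow> (E has_real_derivative E' t) (at t)"
    and le: "\<And>t. t \<ge> a \<Longrightarrow> E' t \<le> - h t"
  shows "set_integrable lborel {a..} h"
proof -
  \<comment> \<open>Constant extension to the left of \<open>a\<close>, with the primitive started
    at \<open>a - 1\<close>, gives \<open>F\<close> a two-sided derivative at \<open>a\<close>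
    itself.\<close>
  define H where "H t = h (max a t)" for t
  define F where "F t = integral {a - 1..t} H" for t
  have H: "continuous_on S H" for S
    unfolding H_def by (rule continuous_on_compose2[OF cont]) (auto intro!: continuous_intros)
  have F: "(F has_real_derivative H t) (at t)" if "t \<ge> a" for t
  proof -
    have "(F has_vector_derivative H t) (at t within {a - 1..t + 1})"
      unfolding F_def using that by (intro integral_has_vector_derivative H) auto
    then show ?thesis
      using that by (simp add: at_within_Icc_at has_real_derivative_iff_has_vector_derivative)
  qed
  have H0: "0 \<le> H t" for t by (simp add: H_def nonneg)
  have mono: "F s \<le> F t" if "a \<le> s" "s \<le> t" for s t
  proof (rule DERIV_nonneg_imp_nondecreasing[OF that(2)])
    fix r assume "s \<le> r" "r \<le> t"
    with F[of r] H0[of r] that(1) show "\<exists>y. (F has_real_derivative y) (at r) \<and> 0 \<le> y"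
      by (intro exI[of _ "H r"]) simp
  qed
  have "F t + E t \<le> F a + E a" if "a \<le> t" for t
  proof (rule DERIV_nonpos_imp_nonincreasing[OF that])
    fix s assume "a \<le> s" "s \<le> t"
    then show "\<exists>y. ((\<lambda>t. F t + E t) has_real_derivative y) (at s) \<and> y \<le> 0"
      using DERIV_add[OF F deriv] le[of s] by (intro exI[of _ "H s + E' s"]) (simp add: H_def)
  qed
  then have "F t \<le> F a + E a" if "a \<le> t" for t using E[OF that] that by (smt (verit))
  then have bdd: "bdd_above (F ` {a..})" by (intro bdd_aboveI[of _ "F a + E a"]) auto
  have "(F \<longlongrightarrow> (SUP t\<in>{a..}. F t)) at_top"
  proof (rule increasing_tendsto)
    show "\<forall>\<^sub>F t in at_top. F t \<le> (SUP t\<in>{a..}. F t)"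
      using eventually_ge_at_top[of a] by eventually_elim (auto intro: cSUP_upper bdd)
    fix r assume "r < (SUP t\<in>{a..}. F t)"
    then obtain s where "a \<le> s" "r < F s" using bdd by (auto simp: less_cSUP_iff)
    then have "r < F t" if "s \<le> t" for t using mono[of s t] that by simp
    then show "\<forall>\<^sub>F t in at_top. r < F t"
      by (auto intro: eventually_mono[OF eventually_ge_at_top[of s]])
  qed
  then have fin: "(\<integral>\<^sup>+t. ennreal (H t) * indicator {a..} t \<partial>lborel) < \<infinity>"
    by (subst nn_integral_FTC_atLeast[where F = F])
      (auto intro: F H0 borel_measurable_continuous_onI[OF H])
  have "integrable lborel (\<lambda>t. indicator {a..} t *\<^sub>R H t)"
  proof (rule integrableI_nonneg)
    show "(\<lambda>t. indicator {a..} t *\<^sub>R H t) \<in> borel_measurable lborel"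
      using borel_measurable_continuous_onI[OF H] by measurable
    show "(\<integral>\<^sup>+t. ennreal (indicator {a..} t *\<^sub>R H t) \<partial>lborel) < \<infinity>"
      using fin by (simp add: nn_integral_set_ennreal mult.commute)
  qed (simp add: H0)
  then show ?thesis
    unfolding set_integrable_def
    by (rule Bochner_Integration.integrable_cong[THEN iffD1, rotated 2])
      (auto simp: H_def indicator_def)
qed

section \<open>Classical regularity of the strong solution\<close>

lemma strong_global_solution_classical:
  fixes g :: "'a::euclidean_space \<Rightarrow> real" and x :: "real \<Rightarrow> 'a" and t0 :: real
  defines "v \<equiv> deriv_from t0 x"
  assumes sol: "strong_global_solution g \<alpha> \<beta> t0 u0 v0 x"
    and grad: "continuous_on UNIV (grad g)" and "t0 > 0"
  shows "continuous_on {t0..} x" and "continuous_on {t0..} v"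
    and "\<And>t. t > t0 \<Longrightarrow> (x has_vector_derivative v t) (at t)"
    and "\<And>t. t > t0 \<Longrightarrow>
      (v has_vector_derivative - (\<alpha> / t) *\<^sub>R v t - grad g (x t + (\<beta> / t) *\<^sub>R v t)) (at t)"
proof -
  define y where "y t = x t + (\<beta> / t) *\<^sub>R v t" for t
  \<comment> \<open>The acceleration prescribed by the equation. It is continuous on
    \<open>{t0..}\<close> and agrees with the derivative of \<open>v\<close> almost everywhere, so
    \<open>v\<close> is a primitive of a continuous function.\<close>
  define w where "w t = - (\<alpha> / t) *\<^sub>R v t - grad g (y t)" for t
  have xd: "x differentiable_on {t0..}"
    and ac: "\<And>T. T > t0 \<Longrightarrow> absolutely_continuous_on t0 T v"
    and ae: "AE t in lborel. t0 \<le> t \<longrightarrow> v differentiable (at t within {t0..}) \<and>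
        deriv_from t0 v t + (\<alpha> / t) *\<^sub>R v t + grad g (y t) = 0"
    using sol unfolding strong_global_solution_def locally_absolutely_continuous_from_def v_def y_def
    by auto
  show cx: "continuous_on {t0..} x"
    using xd by (rule differentiable_imp_continuous_on)
  have at_Ici: "at t within {t0..} = at t" if "t > t0" for t
    using that by (intro at_within_interior) simp
  show "(x has_vector_derivative v t) (at t)" if "t > t0" for t
  proof -
    have "x differentiable (at t within {t0..})"
      using xd that by (simp add: differentiable_on_def)
    then show ?thesis
      using at_Ici[OF that] by (simp add: v_def deriv_from_def vector_derivative_works)
  qed
  have cvT: "continuous_on {t0..T} v" if "T > t0" for T
    using ac[OF that] by (rule absolutely_continuous_on_imp_continuous_on)
  show cv: "continuous_on {t0..} v"
    unfolding continuous_on_eq_continuous_within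
  proof
    fix t assume t: "t \<in> {t0..}"
    then have "continuous (at t within {t0..t + 1}) v"
      using cvT[of "t + 1"] by (simp add: continuous_on_eq_continuous_within)
    moreover have "at t within {t0..t + 1} = at t within {t0..}"
      using t by (intro at_within_nhd[of t "{..<t + 1}"]) auto
    ultimately show "continuous (at t within {t0..}) v"
      by (simp add: continuous_within)
  qed
  have cw: "continuous_on {t0..} w"
    unfolding w_def y_def using \<open>t0 > 0\<close>
    by (intro continuous_intros cx cv continuous_on_compose2[OF grad]) auto
  obtain N where N: "N \<in> null_sets lborel"
    and v': "\<And>t. t \<ge> t0 \<Longrightarrow> t \<notin> N \<Longrightarrow> v differentiable (at t within {t0..}) \<and>
        deriv_from t0 v t + (\<alpha> / t) *\<^sub>R v t + grad g (y t) = 0"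
    using ae by (auto elim!: AE_E3)
  have negl: "negligible N"
    using N by (simp add: negligible_iff_null_sets null_sets_completionI)
  have v_int: "(w has_integral v T - v t0) {t0..T}" if "T > t0" for T
  proof (rule absolutely_continuous_on_has_integral[OF ac[OF that] _ negl])
    fix t assume t: "t \<in> {t0..T} - N"
    then have vt: "v differentiable (at t within {t0..})"
        "deriv_from t0 v t + (\<alpha> / t) *\<^sub>R v t + grad g (y t) = 0"
      using v'[of t] by auto
    then have "deriv_from t0 v t = w t"
      by (simp add: w_def algebra_simps eq_neg_iff_add_eq_0)
    with vt(1) have "(v has_vector_derivative w t) (at t within {t0..})"
      by (simp add: deriv_from_def vector_derivative_works)
    then show "(v has_vector_derivative w t) (at t within {t0..T})"
      by (rule has_vector_derivative_within_subset) auto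
  qed (use that in simp)
  show "(v has_vector_derivative - (\<alpha> / t) *\<^sub>R v t - grad g (x t + (\<beta> / t) *\<^sub>R v t)) (at t)"
    if t: "t > t0" for t
  proof -
    have "((\<lambda>s. integral {t0..s} w) has_vector_derivative w t) (at t within {t0..t + 1})"
      using t by (intro integral_has_vector_derivative continuous_on_subset[OF cw]) auto
    then have "((\<lambda>s. v t0 + integral {t0..s} w) has_vector_derivative 0 + w t) (at t)"
      using t by (intro has_vector_derivative_add has_vector_derivative_const) (simp add: at_within_Icc_at)
    \<comment> \<open>The integral formula for \<open>v\<close> is known for every endpoint beyond
      \<open>t0\<close>, hence on an open set around \<open>t\<close>, where it transfers the
      derivative.\<close>
    then have "(v has_vector_derivative 0 + w t) (at t)"
      by (rule has_vector_derivative_transform_within_open[where S = "{t0<..}"])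
        (use t in \<open>auto simp: integral_unique[OF v_int]\<close>)
    then show ?thesis by (simp add: w_def y_def)
  qed
qed

section \<open>The energy function and its dissipation\<close>

text \<open>With a general factor \<open>b\<close> in place of \<open>(\<alpha> + 1) / 2\<close>,
  decay needs \<open>b > 2\<close> for the gap in \<open>g\<close> and
  \<open>b < \<alpha> - 1\<close> for the velocity. The midpoint is chosen, so both margins equal
  \<open>(\<alpha> - 3) / 2\<close>. The last coefficient is
  \<open>b * (\<alpha> - 1 - b) / 2\<close>, which cancels the product of \<open>x t - z\<close> and
  \<open>v t\<close> in the derivative.\<close>

definition energy :: "('a::real_inner \<Rightarrow> real) \<Rightarrow> real \<Rightarrow> real \<Rightarrow> 'a \<Rightarrow> (real \<Rightarrow> 'a) \<Rightarrow> (real \<Rightarrow> 'a) \<Rightarrow> real \<Rightarrow> real"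
  where "energy g \<alpha> \<beta> z x v t =
    t\<^sup>2 * (g (x t + (\<beta> / t) *\<^sub>R v t) - g z)
    + (norm (((\<alpha> + 1) / 2) *\<^sub>R (x t - z) + t *\<^sub>R v t))\<^sup>2 / 2
    + (\<alpha> + 1) * (\<alpha> - 3) / 8 * (norm (x t - z))\<^sup>2"

lemma energy_derivative:
  fixes g :: "'a::real_inner \<Rightarrow> real" and x v :: "real \<Rightarrow> 'a"
  assumes D: "GDERIV g (x t + (\<beta> / t) *\<^sub>R v t) :> D"
    and x: "(x has_vector_derivative v t) (at t)"
    and v: "(v has_vector_derivative - (\<alpha> / t) *\<^sub>R v t - D) (at t)"
    and "t > 0"
  shows "(energy g \<alpha> \<beta> z x v has_real_derivative
      2 * t * (g (x t + (\<beta> / t) *\<^sub>R v t) - g z) - \<beta> * (\<alpha> + 1) * (D \<bullet> v t) - t * \<beta> * (D \<bullet> D)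
      - t * ((\<alpha> + 1) / 2) * (D \<bullet> (x t - z)) - t * ((\<alpha> - 3) / 2) * (v t \<bullet> v t)) (at t)"
proof -
  define b where "b = (\<alpha> + 1) / 2"
  have y: "((\<lambda>s. x s + (\<beta> / s) *\<^sub>R v s) has_vector_derivative
      (1 - \<beta> * (\<alpha> + 1) / t\<^sup>2) *\<^sub>R v t - (\<beta> / t) *\<^sub>R D) (at t)"
  proof -
    have "((\<lambda>s. \<beta> / s) has_real_derivative - (\<beta> / t\<^sup>2)) (at t)"
      using \<open>t > 0\<close> by (auto intro!: derivative_eq_intros simp: power2_eq_square)
    from has_vector_derivative_add[OF x has_vector_derivative_scaleR[OF this v]]
    have "((\<lambda>s. x s + (\<beta> / s) *\<^sub>R v s) has_vector_derivative
        v t + ((\<beta> / t) *\<^sub>R (- (\<alpha> / t) *\<^sub>R v t - D) + (- (\<beta> / t\<^sup>2)) *\<^sub>R v t)) (at t)" .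
    also have "v t + ((\<beta> / t) *\<^sub>R (- (\<alpha> / t) *\<^sub>R v t - D) + (- (\<beta> / t\<^sup>2)) *\<^sub>R v t)
        = (1 + (\<beta> / t) * - (\<alpha> / t) - \<beta> / t\<^sup>2) *\<^sub>R v t - (\<beta> / t) *\<^sub>R D"
      by (simp add: scaleR_left_distrib scaleR_left_diff_distrib scaleR_right_diff_distrib)
    also have "1 + (\<beta> / t) * - (\<alpha> / t) - \<beta> / t\<^sup>2 = 1 - \<beta> * (\<alpha> + 1) / t\<^sup>2"
      using \<open>t > 0\<close> by (simp add: field_simps power2_eq_square)
    finally show ?thesis .
  qed
  have w: "((\<lambda>s. b *\<^sub>R (x s - z) + s *\<^sub>R v s) has_vector_derivative (b + 1 - \<alpha>) *\<^sub>R v t - t *\<^sub>R D) (at t)"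
  proof -
    have "((\<lambda>s. b *\<^sub>R (x s - z) + s *\<^sub>R v s) has_vector_derivative
        b *\<^sub>R (v t - 0) + (t *\<^sub>R (- (\<alpha> / t) *\<^sub>R v t - D) + 1 *\<^sub>R v t)) (at t)"
      by (intro has_vector_derivative_add has_vector_derivative_scaleR DERIV_ident v
          bounded_linear.has_vector_derivative[OF bounded_linear_scaleR_right]
          has_vector_derivative_diff has_vector_derivative_const x)
    also have "b *\<^sub>R (v t - 0) + (t *\<^sub>R (- (\<alpha> / t) *\<^sub>R v t - D) + 1 *\<^sub>R v t)
        = (b + 1 - \<alpha>) *\<^sub>R v t - t *\<^sub>R D"
      using \<open>t > 0\<close> by (simp add: algebra_simps)
    finally show ?thesis .
  qed
  have d: "((\<lambda>s. x s - z) has_vector_derivative v t) (at t)"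
    by (auto intro!: derivative_eq_intros x)
  define G where "G = g (x t + (\<beta> / t) *\<^sub>R v t) - g z"
  \<comment> \<open>Naming the scalar products turns the remaining computation into identities
    between real numbers.\<close>
  define p q r A B where "p = D \<bullet> (x t - z)" and "q = D \<bullet> v t" and "r = (x t - z) \<bullet> v t"
    and "A = D \<bullet> D" and "B = v t \<bullet> v t"
  have inner: "D \<bullet> (x t - z) = p" "(x t - z) \<bullet> D = p" "D \<bullet> v t = q" "v t \<bullet> D = q"
      "(x t - z) \<bullet> v t = r" "D \<bullet> D = A" "v t \<bullet> v t = B"
    by (simp_all add: p_def q_def r_def A_def B_def inner_commute)
  have yD: "((1 - \<beta> * (\<alpha> + 1) / t\<^sup>2) *\<^sub>R v t - (\<beta> / t) *\<^sub>R D) \<bullet> D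
      = (1 - \<beta> * (\<alpha> + 1) / t\<^sup>2) * q - \<beta> / t * A"
    by (simp only: inner_diff_left[of "_ *\<^sub>R _"] inner_scaleR_left inner)
  have "((\<lambda>s. s\<^sup>2 * (g (x s + (\<beta> / s) *\<^sub>R v s) - g z)) has_real_derivative
      2 * t * G + t\<^sup>2 * ((1 - \<beta> * (\<alpha> + 1) / t\<^sup>2) * q - \<beta> / t * A)) (at t)"
    using GDERIV_imp_has_real_derivative[OF y D, unfolded yD]
    by (auto intro!: derivative_eq_intros simp: G_def)
  also have "t\<^sup>2 * ((1 - \<beta> * (\<alpha> + 1) / t\<^sup>2) * q - \<beta> / t * A)
      = t\<^sup>2 * q - \<beta> * (\<alpha> + 1) * q - t * \<beta> * A"
    using \<open>t > 0\<close> by (simp add: field_simps power2_eq_square)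
  finally have 1: "((\<lambda>s. s\<^sup>2 * (g (x s + (\<beta> / s) *\<^sub>R v s) - g z)) has_real_derivative
      2 * t * G + (t\<^sup>2 * q - \<beta> * (\<alpha> + 1) * q - t * \<beta> * A)) (at t)" .
  have ww: "(b *\<^sub>R (x t - z) + t *\<^sub>R v t) \<bullet> ((b + 1 - \<alpha>) *\<^sub>R v t - t *\<^sub>R D)
      = b * (b + 1 - \<alpha>) * r - b * t * p + t * (b + 1 - \<alpha>) * B - t\<^sup>2 * q"
    by (simp only: inner_add_left inner_diff_right[of _ "_ *\<^sub>R _"] inner_scaleR_left inner_scaleR_right inner)
      (simp add: algebra_simps power2_eq_square)
  have 2: "((\<lambda>s. (norm (b *\<^sub>R (x s - z) + s *\<^sub>R v s))\<^sup>2 / 2) has_real_derivative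
      b * (b + 1 - \<alpha>) * r - b * t * p + t * (b + 1 - \<alpha>) * B - t\<^sup>2 * q) (at t)"
    using DERIV_cdivide[OF has_real_derivative_norm_power2[OF w], of 2] unfolding ww
    by (simp only: nonzero_mult_div_cancel_left[OF zero_neq_numeral[symmetric]])
  have 3: "((\<lambda>s. (\<alpha> + 1) * (\<alpha> - 3) / 8 * (norm (x s - z))\<^sup>2) has_real_derivative
      (\<alpha> + 1) * (\<alpha> - 3) / 8 * (2 * r)) (at t)"
    unfolding r_def by (rule DERIV_cmult[OF has_real_derivative_norm_power2[OF d]])
  \<comment> \<open>Two cancellations occur: \<open>t\<^sup>2 * q\<close> between the gap term and
    the squared norm, and the multiples of \<open>r\<close> by the choice of the last
    coefficient.\<close>
  have sum: "2 * t * G + (t\<^sup>2 * q - \<beta> * (\<alpha> + 1) * q - t * \<beta> * A)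
      + (b * (b + 1 - \<alpha>) * r - b * t * p + t * (b + 1 - \<alpha>) * B - t\<^sup>2 * q)
      + (\<alpha> + 1) * (\<alpha> - 3) / 8 * (2 * r)
    = 2 * t * G - \<beta> * (\<alpha> + 1) * q - t * \<beta> * A - t * ((\<alpha> + 1) / 2) * p - t * ((\<alpha> - 3) / 2) * B"
    unfolding b_def by (simp add: field_simps power2_eq_square)
  from DERIV_add[OF DERIV_add[OF 1 2] 3] show ?thesis
    unfolding sum unfolding energy_def b_def G_def p_def q_def A_def B_def .
qed

text \<open>Convexity turns \<open>-(\<alpha>+1)/2 * t * (D \<bullet> (x - z))\<close> into a multiple of the gap that dominates
  \<open>2 * t\<close> times the gap because \<open>\<alpha> > 3\<close>; the remaining mixed term \<open>D \<bullet> v\<close> has a bounded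
  coefficient, whereas the negative squares carry a factor \<open>t\<close>.\<close>

lemma energy_dissipation:
  fixes g :: "'a::real_inner \<Rightarrow> real" and x v :: "real \<Rightarrow> 'a"
  assumes "convex_on UNIV g" and "\<And>y. g z \<le> g y"
    and D: "GDERIV g (x t + (\<beta> / t) *\<^sub>R v t) :> D"
    and x: "(x has_vector_derivative v t) (at t)"
    and v: "(v has_vector_derivative - (\<alpha> / t) *\<^sub>R v t - D) (at t)"
    and "\<alpha> > 3" "\<beta> \<ge> 0" "t > 0"
    and t1: "t \<ge> (\<alpha> + 1) / 4" and t2: "t \<ge> \<beta> * (\<alpha> + 1) / (\<alpha> - 3)"
  shows "\<exists>E'. (energy g \<alpha> \<beta> z x v has_real_derivative E') (at t) \<and>
    E' \<le> - ((\<alpha> - 3) / 4 * (t * (norm (v t))\<^sup>2))"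
proof -
  define y where "y = x t + (\<beta> / t) *\<^sub>R v t"
  define p q A B G where "p = D \<bullet> (x t - z)" and "q = D \<bullet> v t" and "A = D \<bullet> D"
    and "B = v t \<bullet> v t" and "G = g y - g z"
  have "G \<ge> 0" using assms(2) by (simp add: G_def)
  have "A \<ge> 0" "B \<ge> 0" by (simp_all add: A_def B_def)
  have "g z \<ge> g y + (z - y) \<bullet> D"
    using convex_on_above_gderiv[OF assms(1) D] by (simp add: y_def)
  moreover have "(z - y) \<bullet> D = - p - \<beta> / t * q"
    by (simp add: y_def p_def q_def inner_simps inner_commute)
  ultimately have "p \<ge> G - \<beta> / t * q" by (simp add: G_def)
  then have "t * ((\<alpha> + 1) / 2) * p \<ge> t * ((\<alpha> + 1) / 2) * (G - \<beta> / t * q)"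
    using \<open>t > 0\<close> \<open>\<alpha> > 3\<close> by (intro mult_left_mono) auto
  also have "t * ((\<alpha> + 1) / 2) * (G - \<beta> / t * q) = t * ((\<alpha> + 1) / 2) * G - \<beta> * ((\<alpha> + 1) / 2) * q"
    using \<open>t > 0\<close> by (simp add: field_simps)
  finally have 1: "t * ((\<alpha> + 1) / 2) * p \<ge> t * ((\<alpha> + 1) / 2) * G - \<beta> * ((\<alpha> + 1) / 2) * q" .
  have 2: "2 * t * G \<le> t * ((\<alpha> + 1) / 2) * G"
    using \<open>t > 0\<close> \<open>\<alpha> > 3\<close> \<open>G \<ge> 0\<close> by (intro mult_right_mono) auto
  \<comment> \<open>Young's inequality for the mixed term. Convexity has already absorbed half of
    \<open>\<beta> * (\<alpha> + 1) * q\<close>. In what is left, \<open>t1\<close> lets the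
    \<open>A\<close> part be absorbed by \<open>t * \<beta> * A\<close>, and \<open>t2\<close> lets
    the \<open>B\<close> part use half of the available
    \<open>t * ((\<alpha> - 3) / 2) * B\<close>.\<close>
  have "0 \<le> (D + v t) \<bullet> (D + v t)" by simp
  then have "- 2 * q \<le> A + B" by (simp add: q_def A_def B_def inner_simps inner_commute)
  then have "\<beta> * ((\<alpha> + 1) / 4) * (- 2 * q) \<le> \<beta> * ((\<alpha> + 1) / 4) * (A + B)"
    using \<open>\<alpha> > 3\<close> \<open>\<beta> \<ge> 0\<close> by (intro mult_left_mono) auto
  moreover have "\<beta> * ((\<alpha> + 1) / 4) * A \<le> \<beta> * t * A"
    using t1 \<open>\<beta> \<ge> 0\<close> \<open>A \<ge> 0\<close> by (intro mult_right_mono mult_left_mono) auto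
  moreover have "\<beta> * ((\<alpha> + 1) / 4) * B \<le> (\<alpha> - 3) / 4 * t * B"
    using t2 \<open>\<alpha> > 3\<close> \<open>B \<ge> 0\<close> by (intro mult_right_mono) (auto simp: field_simps)
  ultimately have 3: "- (\<beta> * ((\<alpha> + 1) / 2) * q) \<le> \<beta> * t * A + (\<alpha> - 3) / 4 * t * B"
    by argo
  have "2 * t * G - \<beta> * (\<alpha> + 1) * q - t * \<beta> * A - t * ((\<alpha> + 1) / 2) * p - t * ((\<alpha> - 3) / 2) * B
      \<le> - ((\<alpha> - 3) / 4 * (t * B))"
    using 1 2 3 by (simp add: field_simps)
  with energy_derivative[OF D x v \<open>t > 0\<close>, of z] show ?thesis
    unfolding p_def q_def A_def B_def G_def y_def power2_norm_eq_inner by blast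
qed

section \<open>Bounds and rates drawn from the energy\<close>

theorem mainTheorem6:
  fixes g :: "real ^ 'm \<Rightarrow> real"
    and x :: "real \<Rightarrow> real ^ 'm"
    and u0 v0 :: "real ^ 'm"
    and L t0 \<alpha> \<beta> :: real
  assumes "convex_on UNIV g"
    and "\<forall>z. g differentiable (at z)"
    and "L-lipschitz_on UNIV (grad g)"
    and "argmin_set g \<noteq> {}"
    and "t0 > 0"
    and "\<alpha> > 3"
    and "\<beta> \<ge> 0"
    and "strong_global_solution g \<alpha> \<beta> t0 u0 v0 x"
  shows "bounded (x ` {t0..}) \<and>
    (\<exists>K\<ge>0. \<exists>t1\<ge>t0. \<forall>t\<ge>t1. norm (deriv_from t0 x t) \<le> K / t) \<and>
    set_integrable lborel {t0..} (\<lambda>t. t * (norm (deriv_from t0 x t))\<^sup>2) \<and>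
    (\<exists>K1\<ge>0. \<exists>t2\<ge>t0. \<forall>t\<ge>t2. g (x t) - min_value g \<le> K1 / t\<^sup>2)"
proof -
  define v where "v = deriv_from t0 x"
  obtain z where z: "\<And>y. g z \<le> g y"
    using assms(4) by (auto simp: argmin_set_def)
  then have min: "min_value g = g z"
    unfolding min_value_def by (intro Least_equality) auto
  have D: "GDERIV g w :> grad g w" for w
    using assms(2) by (simp add: GDERIV_grad)
  note sol = strong_global_solution_classical[OF assms(8) lipschitz_on_continuous_on[OF assms(3)] assms(5),
      folded v_def]
  \<comment> \<open>The entry \<open>t0 + 1\<close> keeps \<open>t1\<close> strictly beyond
    \<open>t0\<close>, where two-sided derivatives exist; the others are the thresholds of the
    dissipation estimate.\<close>
  define t1 where "t1 = max (t0 + 1) (max ((\<alpha> + 1) / 4) (\<beta> * (\<alpha> + 1) / (\<alpha> - 3)))"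
  have t1: "t1 > t0" "t1 > 0" using assms(5) by (auto simp: t1_def)
  define E where "E = energy g \<alpha> \<beta> z x v"
  define h where "h t = t * (norm (v t))\<^sup>2" for t
  have "\<exists>E'. (E has_real_derivative E') (at t) \<and> E' \<le> - ((\<alpha> - 3) / 4 * h t)" if "t \<ge> t1" for t
    unfolding E_def h_def using that t1 assms(6,7)
    by (intro energy_dissipation[OF assms(1) z D] sol(3,4)) (auto simp: t1_def)
  then obtain E' where E': "\<And>t. t \<ge> t1 \<Longrightarrow> (E has_real_derivative E' t) (at t)"
      "\<And>t. t \<ge> t1 \<Longrightarrow> E' t \<le> - ((\<alpha> - 3) / 4 * h t)"
    by metis
  have h0: "0 \<le> (\<alpha> - 3) / 4 * h t" if "t \<ge> t1" for t
    using that t1 assms(6) by (simp add: h_def)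

  define k where "k = (\<alpha> + 1) * (\<alpha> - 3) / 8"
  have "k > 0" using assms(6) by (simp add: k_def)
  define y where "y t = x t + (\<beta> / t) *\<^sub>R v t" for t
  define w where "w t = ((\<alpha> + 1) / 2) *\<^sub>R (x t - z) + t *\<^sub>R v t" for t
  have E_eq: "E t = t\<^sup>2 * (g (y t) - g z) + (norm (w t))\<^sup>2 / 2 + k * (norm (x t - z))\<^sup>2" for t
    by (simp add: E_def energy_def y_def w_def k_def)
  have parts: "0 \<le> t\<^sup>2 * (g (y t) - g z)" "0 \<le> k * (norm (x t - z))\<^sup>2" for t
    using z \<open>k > 0\<close> by simp_all
  then have E0: "0 \<le> E t" for t by (simp add: E_eq)
  define M where "M = E t1"
  have EM: "E t \<le> M" if "t \<ge> t1" for t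
    unfolding M_def
  proof (rule DERIV_nonpos_imp_nonincreasing[OF that])
    fix s assume "t1 \<le> s"
    then show "\<exists>E'. (E has_real_derivative E') (at s) \<and> E' \<le> 0"
      using E'[of s] h0[of s] by (intro exI[of _ "E' s"]) simp
  qed
  have "M \<ge> 0" by (simp add: M_def E0)
  \<comment> \<open>Solves \<open>k * R\<^sup>2 = M\<close>: the last energy term alone is at most
    \<open>M\<close>.\<close>
  define R where "R = sqrt (M / k)"
  have "R \<ge> 0" using \<open>M \<ge> 0\<close> \<open>k > 0\<close> by (simp add: R_def)
  have xR: "norm (x t - z) \<le> R" if "t \<ge> t1" for t
    unfolding R_def
  proof (rule real_le_rsqrt)
    have "k * (norm (x t - z))\<^sup>2 \<le> M"
      using EM[OF that] parts(1)[of t] zero_le_power2[of "norm (w t)"] unfolding E_eq by linarith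
    then show "(norm (x t - z))\<^sup>2 \<le> M / k"
      using \<open>k > 0\<close> by (simp add: field_simps)
  qed
  \<comment> \<open>The energy gives \<open>norm (w t) \<le> sqrt (2 * M)\<close>; subtracting the
    position part of \<open>w t\<close>, bounded through \<open>R\<close>, leaves
    \<open>t *\<^sub>R v t\<close>.\<close>
  define K where "K = sqrt (2 * M) + (\<alpha> + 1) / 2 * R"
  have "K \<ge> 0" using \<open>M \<ge> 0\<close> \<open>R \<ge> 0\<close> assms(6) by (simp add: K_def)
  have vK: "norm (v t) \<le> K / t" if "t \<ge> t1" for t
  proof -
    have "(norm (w t))\<^sup>2 \<le> 2 * M"
      using EM[OF that] parts[of t] unfolding E_eq by linarith
    then have "norm (w t) \<le> sqrt (2 * M)" by (rule real_le_rsqrt)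
    moreover have "norm (((\<alpha> + 1) / 2) *\<^sub>R (x t - z)) \<le> (\<alpha> + 1) / 2 * R"
      using xR[OF that] assms(6) by simp
    moreover have "t *\<^sub>R v t = w t - ((\<alpha> + 1) / 2) *\<^sub>R (x t - z)" by (simp add: w_def)
    ultimately have "norm (t *\<^sub>R v t) \<le> K"
      by (simp only: K_def) (intro norm_triangle_le_diff add_mono)
    then show ?thesis using that t1 by (simp add: field_simps)
  qed

  have "bounded (x ` {t0..t1})"
    by (intro compact_imp_bounded compact_continuous_image continuous_on_subset[OF sol(1)]) auto
  moreover have "bounded (x ` {t1..})"
    unfolding bounded_def
    by (intro exI[of _ z] exI[of _ R]) (use xR in \<open>auto simp: dist_norm norm_minus_commute\<close>)
  moreover have Ici: "{t0..} = {t0..t1} \<union> {t1..}" using t1 by auto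
  ultimately have bdd: "bounded (x ` {t0..})" by (simp add: image_Un)

  have ch: "continuous_on {t0..} h"
    unfolding h_def by (intro continuous_intros sol(2))
  \<comment> \<open>The energy dissipation gives integrability of the tail; on
    \<open>{t0..t1}\<close> continuity suffices.\<close>
  have "set_integrable lborel {t1..} (\<lambda>t. (\<alpha> - 3) / 4 * h t)"
    by (rule set_integrable_atLeast_dissipation[OF _ h0 E0 E'])
      (use t1 in \<open>auto intro!: continuous_intros continuous_on_subset[OF ch]\<close>)
  then have "set_integrable lborel {t1..} h"
    using assms(6) by simp
  moreover have "set_integrable lborel {t0..t1} h"
    by (intro borel_integrable_atLeastAtMost' continuous_on_subset[OF ch]) auto
  ultimately have int: "set_integrable lborel {t0..} h"
    unfolding Ici by (intro set_integrable_Un) auto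

  \<comment> \<open>Bound for the gradient along \<open>x\<close> from \<open>t1\<close> on, by the
    Lipschitz condition relative to \<open>z\<close>.\<close>
  define \<Gamma> where "\<Gamma> = norm (grad g z) + L * R"
  have L: "L \<ge> 0" using assms(3) by (rule lipschitz_on_nonneg)
  have gx: "g (x t) - min_value g \<le> (M + \<beta> * K * \<Gamma>) / t\<^sup>2" if t: "t \<ge> t1" for t
  proof -
    have "t > 0" using t t1 by simp
    have "norm (grad g (x t) - grad g z) \<le> L * norm (x t - z)"
      using lipschitz_onD[OF assms(3)] by (simp add: dist_norm)
    also have "\<dots> \<le> L * R" using xR[OF t] L by (rule mult_left_mono)
    finally have \<Gamma>: "norm (grad g (x t)) \<le> \<Gamma>"
      unfolding \<Gamma>_def using norm_triangle_sub[of "grad g (x t)" "grad g z"] by linarith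
    \<comment> \<open>The tangent is taken at \<open>x t\<close>, not at \<open>y t\<close>, so that
      the gradient involved is the one bounded by \<open>\<Gamma>\<close>. The displacement
      \<open>y t - x t\<close> is \<open>\<beta> / t\<close> times the velocity, hence of order
      \<open>1 / t\<^sup>2\<close>.\<close>
    have "g (x t) \<le> g (y t) - (y t - x t) \<bullet> grad g (x t)"
      using convex_on_above_gderiv[OF assms(1) D, of "x t" "y t"] by simp
    also have "- ((y t - x t) \<bullet> grad g (x t)) \<le> norm (y t - x t) * norm (grad g (x t))"
      using Cauchy_Schwarz_ineq2[of "y t - x t" "grad g (x t)"] by linarith
    then have "g (y t) - (y t - x t) \<bullet> grad g (x t) \<le> g (y t) + norm (y t - x t) * norm (grad g (x t))"
      by simp
    also have "norm (y t - x t) * norm (grad g (x t)) \<le> (\<beta> / t * (K / t)) * \<Gamma>"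
    proof (rule mult_mono[OF _ \<Gamma>])
      show "norm (y t - x t) \<le> \<beta> / t * (K / t)"
        using mult_left_mono[OF vK[OF t], of "\<beta> / t"] assms(7) \<open>t > 0\<close> by (simp add: y_def)
    qed (use assms(7) \<open>t > 0\<close> \<open>K \<ge> 0\<close> in auto)
    finally have "g (x t) \<le> g (y t) + (\<beta> / t * (K / t)) * \<Gamma>" by simp
    moreover have "t\<^sup>2 * (g (y t) - g z) \<le> M"
      using EM[OF t] parts(2)[of t] zero_le_power2[of "norm (w t)"] unfolding E_eq by linarith
    then have "g (y t) - g z \<le> M / t\<^sup>2"
      using \<open>t > 0\<close> by (simp add: field_simps)
    moreover have "(M + \<beta> * K * \<Gamma>) / t\<^sup>2 = M / t\<^sup>2 + (\<beta> / t * (K / t)) * \<Gamma>"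
      by (simp add: add_divide_distrib power2_eq_square)
    ultimately show ?thesis unfolding min by linarith
  qed
  have "M + \<beta> * K * \<Gamma> \<ge> 0"
    using \<open>M \<ge> 0\<close> \<open>K \<ge> 0\<close> \<open>R \<ge> 0\<close> L assms(7) by (simp add: \<Gamma>_def)
  with bdd int vK gx \<open>K \<ge> 0\<close> t1(1) show ?thesis
    unfolding v_def h_def by (meson less_imp_le)
qed

end
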